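(* For any fixed $\hat\theta_N\in\Theta$ and $\hat r_N\ge0$, the optimal value function $\nu^\lambda(\cdot,\hat\theta_N,\hat r_N)$ converges to $\nu(\cdot,\hat\theta_N,\hat r_N)$ uniformly over $x\in\mathcal X$ as $\lambda\downarrow0$. Moreover, for any fixed $x\in\mathcal X$, the unique maximizer $\vartheta^\lambda(x,\hat\theta_N,\hat r_N)$ of the regularized lower-level problem converges, as $\lambda\downarrow0$, to the unique least-norm solution of the unregularized problem, i.e. $$\vartheta^\lambda(x,\hat\theta_N,\hat r_N)\to\theta_N^{\min}:=\arg\min_{\theta\in\vartheta(x,\hat\theta_N,\hat r_N)}\|\theta\|.$$
   Context: $\mathcal X\subseteq\mathbb R^d$ is nonempty closed convex; $Q_1,\dots,Q_n$ are fixed probability distributions on $\Xi\subseteq\mathbb R^m$; $\varphi:\mathcal X\times\Xi\to\mathbb R$ is continuous in $x$ and measurable and $Q_j$-integrable in $\xi$ for each $j$. $\Theta=\{\theta\in\mathbb R^n_+\mid\sum_j\theta_j=1\}$, $\hat\Theta_N=\{\theta\in\Theta\mid\|\theta-\hat\theta_N\|_\infty\le\hat r_N\}$, and $\|\cdot\|$ is the Euclidean norm. For $\lambda\ge0$, $\nu^\lambda(x,\hat\theta_N,\hat r_N)$ and $\vartheta^\lambda(x,\hat\theta_N,\hat r_N)$ denote the optimal value and the set of maximizers of $\max_{\theta\in\hat\Theta_N}\{\sum_{j=1}^n\theta_j\mathbb E_{Q_j}[\varphi(x,\xi)]-\lambda\|\theta\|^2\}$; $\nu:=\nu^0$ and $\vartheta:=\vartheta^0$.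 For $\lambda>0$ the maximizer is unique and $\vartheta^\lambda$ is identified with it. *)

theory Defs
  imports "HOL-Probability.Probability"
begin

definition weight_simplex :: "(real ^ 'n::finite) set" where
  "weight_simplex = {\<theta>. (\<forall>j. 0 \<le> \<theta> $ j) \<and> (\<Sum>j\<in>UNIV. \<theta> $ j) = 1}"

definition ambiguity_set :: "real ^ 'n::finite \<Rightarrow> real \<Rightarrow> (real ^ 'n) set" where
  "ambiguity_set \<theta>h r = {\<theta> \<in> weight_simplex. infnorm (\<theta> - \<theta>h) \<le> r}"

definition lower_obj ::
  "('n::finite \<Rightarrow> (real ^ 'm::finite) measure) \<Rightarrow> (real ^ 'd::finite \<Rightarrow> real ^ 'm \<Rightarrow> real)
    \<Rightarrow> real \<Rightarrow> real ^ 'd \<Rightarrow> real ^ 'n \<Rightarrow> real" where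
  "lower_obj Q \<phi> lam x \<theta> =
     (\<Sum>j\<in>UNIV. \<theta> $ j * (\<integral>\<xi>. \<phi> x \<xi> \<partial>(Q j))) - lam * (norm \<theta>)\<^sup>2"

text \<open>The supremum below is that of a continuous function over a compact set, which is
  nonempty when \<open>\<theta>h \<in> weight_simplex\<close> and \<open>r \<ge> 0\<close>; it is then an attained maximum.\<close>

definition opt_value ::
  "('n::finite \<Rightarrow> (real ^ 'm::finite) measure) \<Rightarrow> (real ^ 'd::finite \<Rightarrow> real ^ 'm \<Rightarrow> real)
    \<Rightarrow> real \<Rightarrow> real ^ 'd \<Rightarrow> real ^ 'n \<Rightarrow> real \<Rightarrow> real" where
  "opt_value Q \<phi> lam x \<theta>h r = (SUP \<theta> \<in> ambiguity_set \<theta>h r. lower_obj Q \<phi> lam x \<theta>)"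

definition maximizers ::
  "('n::finite \<Rightarrow> (real ^ 'm::finite) measure) \<Rightarrow> (real ^ 'd::finite \<Rightarrow> real ^ 'm \<Rightarrow> real)
    \<Rightarrow> real \<Rightarrow> real ^ 'd \<Rightarrow> real ^ 'n \<Rightarrow> real \<Rightarrow> (real ^ 'n) set" where
  "maximizers Q \<phi> lam x \<theta>h r =
     {\<theta>. is_arg_max (lower_obj Q \<phi> lam x) (\<lambda>\<theta>. \<theta> \<in> ambiguity_set \<theta>h r) \<theta>}"

end

theory Submission
  imports Defs
begin

text \<open>Completing the square, \<open>c \<bullet> \<theta> - t \<parallel>\<theta>\<parallel>\<^sup>2\<close> equals \<open>- t \<parallel>\<theta> - c / (2 t)\<parallel>\<^sup>2\<close> up to a constant, so
  for \<open>t > 0\<close> the regularized maximizer is the projection of \<open>c / (2 t)\<close> onto the feasible set.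
  Comparing it with the least-norm unregularized maximizer \<open>\<theta>\<^sup>*\<close> gives \<open>\<parallel>\<theta>\<^sub>t\<parallel> \<le> \<parallel>\<theta>\<^sup>*\<parallel>\<close> and
  \<open>c \<bullet> \<theta>\<^sub>t \<ge> c \<bullet> \<theta>\<^sup>* - t \<parallel>\<theta>\<^sup>*\<parallel>\<^sup>2\<close>. On the compact set of feasible points of norm at most \<open>\<parallel>\<theta>\<^sup>*\<parallel>\<close>
  and at distance at least \<open>\<epsilon>\<close> from \<open>\<theta>\<^sup>*\<close> the linear objective stays away from its maximum, so
  \<open>\<theta>\<^sub>t\<close> leaves that set as \<open>t \<down> 0\<close>. The values differ by at most \<open>t\<close> times a bound for \<open>\<parallel>\<theta>\<parallel>\<^sup>2\<close>
  over the feasible set, which does not involve \<open>x\<close>.\<close>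

lemma compact_weight_simplex: "compact (weight_simplex :: (real ^ 'n::finite) set)"
proof -
  have "norm \<theta> \<le> 1" if "\<theta> \<in> weight_simplex" for \<theta> :: "real ^ 'n"
    using norm_le_l1_cart[of \<theta>] that by (simp add: weight_simplex_def)
  then have "bounded (weight_simplex :: (real ^ 'n) set)"
    by (auto simp: bounded_iff)
  moreover have "closed (weight_simplex :: (real ^ 'n) set)"
    unfolding weight_simplex_def
    by (intro closed_Collect_conj closed_Collect_all closed_Collect_le closed_Collect_eq
        continuous_intros)
  ultimately show ?thesis
    by (simp add: compact_eq_bounded_closed)
qed

lemma convex_weight_simplex: "convex weight_simplex"
  unfolding convex_def weight_simplex_def
  by (auto simp: sum.distrib simp flip: sum_distrib_left)

lemma compact_ambiguity_set: "compact (ambiguity_set \<theta>h r)"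
proof -
  have "ambiguity_set \<theta>h r = weight_simplex \<inter> {\<theta>. infnorm (\<theta> - \<theta>h) \<le> r}"
    by (auto simp: ambiguity_set_def)
  moreover have "closed {\<theta>. infnorm (\<theta> - \<theta>h) \<le> r}"
    by (intro closed_Collect_le continuous_intros)
  ultimately show ?thesis
    using compact_Int_closed[OF compact_weight_simplex] by metis
qed

text \<open>\<open>infnorm\<close> is not the Euclidean norm of the type, so these sets are not
  \<open>cball\<close>s; their convexity comes from the triangle inequality and homogeneity of
  \<open>infnorm\<close>.\<close>

lemma convex_infnorm_cball: "convex {x :: 'a::euclidean_space. infnorm (x - a) \<le> r}"
proof (rule convexI)
  fix x y :: 'a and u v :: real
  assume xy: "x \<in> {x. infnorm (x - a) \<le> r}" "y \<in> {x. infnorm (x - a) \<le> r}"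
    and uv: "0 \<le> u" "0 \<le> v" "u + v = 1"
  have "u *\<^sub>R x + v *\<^sub>R y - a = u *\<^sub>R (x - a) + v *\<^sub>R (y - a)"
    using uv(3) by (simp add: algebra_simps flip: scaleR_left.add)
  then have "infnorm (u *\<^sub>R x + v *\<^sub>R y - a) \<le> u * infnorm (x - a) + v * infnorm (y - a)"
    using infnorm_triangle[of "u *\<^sub>R (x - a)" "v *\<^sub>R (y - a)"] uv by (simp add: infnorm_mul)
  also have "\<dots> \<le> r"
    using xy uv by (intro convex_bound_le) auto
  finally show "u *\<^sub>R x + v *\<^sub>R y \<in> {x. infnorm (x - a) \<le> r}"
    by simp
qed

lemma convex_ambiguity_set: "convex (ambiguity_set \<theta>h r)"
  using convex_Int[OF convex_weight_simplex convex_infnorm_cball[of \<theta>h r]]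
  by (simp add: ambiguity_set_def Int_def)

lemma center_in_ambiguity_set:
  assumes "\<theta>h \<in> weight_simplex" "0 \<le> r"
  shows "\<theta>h \<in> ambiguity_set \<theta>h r"
  using assms by (simp add: ambiguity_set_def infnorm_0)

lemma lower_obj_eq_inner:
  "lower_obj Q \<phi> lam x \<theta> = (\<chi> j. \<integral>\<xi>. \<phi> x \<xi> \<partial>Q j) \<bullet> \<theta> - lam * (norm \<theta>)\<^sup>2"
  by (simp add: lower_obj_def inner_vec_def mult.commute)

lemma SUP_eq_arg_max:
  fixes f :: "'a \<Rightarrow> real"
  assumes "is_arg_max f (\<lambda>x. x \<in> K) a"
  shows "(SUP x\<in>K. f x) = f a"
  using assms by (intro cSup_eq_maximum) (auto simp: is_arg_max_linorder)

lemma ex_is_arg_max_compact: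
  fixes f :: "'a::topological_space \<Rightarrow> real"
  assumes "compact K" "K \<noteq> {}" "continuous_on K f"
  obtains a where "is_arg_max f (\<lambda>x. x \<in> K) a"
  using continuous_attains_sup[OF assms] by (auto simp: is_arg_max_linorder)

text \<open>With \<open>a\<close> maximizing \<open>f\<close> and \<open>b\<close> maximizing
  \<open>g\<close>, f b - g b \<le> f a - g b \<le> f a - g a, and both ends are at most
  \<open>e\<close> in absolute value.\<close>

lemma abs_SUP_diff_le:
  fixes f g :: "'a::topological_space \<Rightarrow> real"
  assumes "compact K" "K \<noteq> {}" "continuous_on K f" "continuous_on K g"
    and le: "\<And>x. x \<in> K \<Longrightarrow> \<bar>f x - g x\<bar> \<le> e"
  shows "\<bar>(SUP x\<in>K. f x) - (SUP x\<in>K. g x)\<bar> \<le> e"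
proof -
  obtain a where a: "is_arg_max f (\<lambda>x. x \<in> K) a"
    using assms ex_is_arg_max_compact by blast
  obtain b where b: "is_arg_max g (\<lambda>x. x \<in> K) b"
    using assms ex_is_arg_max_compact by blast
  have "a \<in> K" "b \<in> K" "f b \<le> f a" "g a \<le> g b"
    using a b by (auto simp: is_arg_max_linorder)
  then show ?thesis
    unfolding SUP_eq_arg_max[OF a] SUP_eq_arg_max[OF b] using le[of a] le[of b] by linarith
qed

text \<open>The norm is the distance to the origin, so the minimizer is the projection of 0 onto
  \<open>S\<close>.\<close>

lemma ex1_arg_min_norm:
  fixes S :: "'a::euclidean_space set"
  assumes "closed S" "convex S" "S \<noteq> {}"
  shows "\<exists>!x. is_arg_min norm (\<lambda>x. x \<in> S) x"
proof (rule ex_ex1I)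
  show "\<exists>x. is_arg_min norm (\<lambda>x. x \<in> S) x"
    using distance_attains_inf[OF assms(1,3), of 0] by (auto simp: is_arg_min_linorder)
  show "x = y" if "is_arg_min norm (\<lambda>x. x \<in> S) x" "is_arg_min norm (\<lambda>x. x \<in> S) y" for x y
    using any_closest_point_unique[OF assms(2,1), of x y 0] that
    by (auto simp: is_arg_min_linorder)
qed

lemma ex1_arg_max_regularized:
  fixes K :: "'a::euclidean_space set"
  assumes "closed K" "convex K" "K \<noteq> {}" "t > 0"
  shows "\<exists>!\<theta>. is_arg_max (\<lambda>\<theta>. c \<bullet> \<theta> - t * (norm \<theta>)\<^sup>2) (\<lambda>\<theta>. \<theta> \<in> K) \<theta>"
proof -
  \<comment> \<open>The point where the gradient \<open>c - 2 t \<theta>\<close> of the regularized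
    objective vanishes.\<close>
  define a where "a = c /\<^sub>R (2 * t)"
  have sq: "c \<bullet> \<theta> - t * (norm \<theta>)\<^sup>2 = t * (norm a)\<^sup>2 - t * (dist a \<theta>)\<^sup>2" for \<theta>
  proof -
    have "c = (2 * t) *\<^sub>R a"
      using \<open>t > 0\<close> by (simp add: a_def)
    then show ?thesis
      by (simp add: dist_norm power2_norm_eq_inner inner_diff inner_commute algebra_simps)
  qed
  have iff: "is_arg_max (\<lambda>\<theta>. c \<bullet> \<theta> - t * (norm \<theta>)\<^sup>2) (\<lambda>\<theta>. \<theta> \<in> K) \<theta>
      \<longleftrightarrow> \<theta> \<in> K \<and> (\<forall>z\<in>K. dist a \<theta> \<le> dist a z)" for \<theta>
    using \<open>t > 0\<close> by (auto simp: is_arg_max_linorder sq power_mono_iff)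
  show ?thesis
    unfolding iff
  proof (rule ex_ex1I)
    show "\<exists>\<theta>. \<theta> \<in> K \<and> (\<forall>z\<in>K. dist a \<theta> \<le> dist a z)"
      by (rule distance_attains_inf[OF assms(1,3), of a]) blast
    show "x = y" if "x \<in> K \<and> (\<forall>z\<in>K. dist a x \<le> dist a z)"
      "y \<in> K \<and> (\<forall>z\<in>K. dist a y \<le> dist a z)" for x y
      using any_closest_point_unique[OF assms(2,1)] that by blast
  qed
qed

text \<open>The maximizers are the slice of \<open>K\<close> by the hyperplane at the maximal level.
  This supplies the hypotheses of \<open>ex1_arg_min_norm\<close>.\<close>

lemma arg_max_inner_set:
  fixes K :: "'a::euclidean_space set" and c :: 'a
  assumes "compact K" "convex K" "K \<noteq> {}"
  defines "S \<equiv> {\<theta>. is_arg_max ((\<bullet>) c) (\<lambda>\<theta>. \<theta> \<in> K) \<theta>}"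
  shows "closed S" "convex S" "S \<noteq> {}"
proof -
  have "continuous_on K ((\<bullet>) c)"
    by (intro continuous_intros)
  from ex_is_arg_max_compact[OF assms(1,3) this]
  obtain a where a: "is_arg_max ((\<bullet>) c) (\<lambda>x. x \<in> K) a" .
  then have S: "S = K \<inter> {\<theta>. c \<bullet> \<theta> = c \<bullet> a}"
    by (auto simp: S_def is_arg_max_linorder intro: antisym)
  show "closed S"
    unfolding S using compact_imp_closed[OF assms(1)] by (intro closed_Int closed_hyperplane)
  show "convex S"
    unfolding S by (intro convex_Int assms convex_hyperplane)
  show "S \<noteq> {}"
    using a by (auto simp: S_def)
qed

text \<open>Stated for any continuous \<open>f\<close> and any selection \<open>\<theta>\<close> of
  regularized maximizers; in the application to a linear \<open>f\<close>, convexity of the feasible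
  set yields \<open>uniq\<close>.\<close>

lemma tendsto_regularized_arg_max:
  fixes f :: "'a::euclidean_space \<Rightarrow> real"
  assumes "compact K" "continuous_on K f"
    and m: "is_arg_min norm (is_arg_max f (\<lambda>\<theta>. \<theta> \<in> K)) m"
    and uniq: "\<And>m'. is_arg_min norm (is_arg_max f (\<lambda>\<theta>. \<theta> \<in> K)) m' \<Longrightarrow> m' = m"
    and \<theta>: "\<And>t. t > 0 \<Longrightarrow> is_arg_max (\<lambda>\<theta>. f \<theta> - t * (norm \<theta>)\<^sup>2) (\<lambda>\<theta>. \<theta> \<in> K) (\<theta> t)"
  shows "(\<theta> \<longlongrightarrow> m) (at_right 0)"
proof (rule tendstoI)
  fix e :: real
  assume "e > 0"
  have mK: "m \<in> K" and max: "\<And>y. y \<in> K \<Longrightarrow> f y \<le> f m"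
    using m by (auto simp: is_arg_min_linorder is_arg_max_linorder)
  have \<theta>K: "\<theta> t \<in> K" and lower: "f m - t * (norm m)\<^sup>2 \<le> f (\<theta> t) - t * (norm (\<theta> t))\<^sup>2" if "t > 0" for t
    using \<theta>[OF that] mK by (auto simp: is_arg_max_linorder)
  have norm_le: "norm (\<theta> t) \<le> norm m" if "t > 0" for t
  proof -
    \<comment> \<open>Since \<open>m\<close> maximizes \<open>f\<close>, the values of
      \<open>f\<close> in \<open>lower\<close> can be cancelled.\<close>
    have "t * (norm (\<theta> t))\<^sup>2 \<le> t * (norm m)\<^sup>2"
      using lower[OF that] max[OF \<theta>K[OF that]] by linarith
    then show ?thesis
      using that by (simp add: power_mono_iff)
  qed
  \<comment> \<open>Removing an open ball keeps \<open>L\<close> compact. It may be empty, in which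
    case no maximum over \<open>L\<close> exists and every t > 0 already satisfies the
    claim.\<close>
  define L where "L = K \<inter> (cball 0 (norm m) - ball m e)"
  have L: "\<theta> t \<in> L" if "t > 0" "\<not> dist (\<theta> t) m < e" for t
    using that \<theta>K norm_le by (auto simp: L_def dist_commute)
  show "\<forall>\<^sub>F t in at_right 0. dist (\<theta> t) m < e"
  proof (cases "L = {}")
    case True
    then show ?thesis
      using L by (intro eventually_at_rightI[of 0 1]) auto
  next
    case False
    have "compact L"
      unfolding L_def using assms(1) by (intro compact_Int_closed closed_Diff) auto
    moreover have "continuous_on L f"
      using assms(2) by (rule continuous_on_subset) (simp add: L_def)
    ultimately obtain b where b: "b \<in> L" "\<And>y. y \<in> L \<Longrightarrow> f y \<le> f b"
      using continuous_attains_sup[of L f] False by blast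
    \<comment> \<open>Otherwise \<open>b\<close> would be a maximizer of \<open>f\<close> with norm
      at most that of \<open>m\<close>, hence another least-norm one, although it lies outside the
      ball around \<open>m\<close>.\<close>
    have "f b \<noteq> f m"
    proof
      assume "f b = f m"
      then have "is_arg_min norm (is_arg_max f (\<lambda>\<theta>. \<theta> \<in> K)) b"
        using m b(1) by (force simp: is_arg_min_linorder is_arg_max_linorder L_def)
      then have "b = m"
        by (rule uniq)
      then show False
        using b(1) \<open>e > 0\<close> by (simp add: L_def)
    qed
    then have "f b < f m"
      using max b(1) by (force simp: L_def)
    moreover have "((\<lambda>t. f m - t * (norm m)\<^sup>2) \<longlongrightarrow> f m) (at_right 0)"
      by (auto intro!: tendsto_eq_intros)
    ultimately have "\<forall>\<^sub>F t in at_right 0. f b < f m - t * (norm m)\<^sup>2"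
      by (rule order_tendstoD(1)[rotated])
    then show ?thesis
      using eventually_at_right_less[of "0::real"]
    proof eventually_elim
      case (elim t)
      \<comment> \<open>The nonnegative penalty at \<open>\<theta> t\<close> is dropped from
        \<open>lower\<close>.\<close>
      have "f (\<theta> t) \<ge> f m - t * (norm m)\<^sup>2"
        using lower[OF elim(2)] elim(2) by (smt (verit) zero_le_mult_iff zero_le_power2)
      then have "\<theta> t \<notin> L"
        using b(2) elim(1) by fastforce
      then show ?case
        using L elim(2) by blast
    qed
  qed
qed

theorem lemma4:
  fixes X :: "(real ^ 'd::finite) set"
    and Xi :: "(real ^ 'm::finite) set"
    and Q :: "'n::finite \<Rightarrow> (real ^ 'm) measure"
    and \<phi> :: "real ^ 'd \<Rightarrow> real ^ 'm \<Rightarrow> real"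
    and \<theta>h :: "real ^ 'n"
    and r :: real
  assumes "X \<noteq> {}" and "closed X" and "convex X"
    and "\<And>j. prob_space (Q j)"
    and "\<And>j. sets (Q j) = sets (restrict_space borel Xi)"
    and "\<And>\<xi>. \<xi> \<in> Xi \<Longrightarrow> continuous_on X (\<lambda>x. \<phi> x \<xi>)"
    and "\<And>x. x \<in> X \<Longrightarrow> \<phi> x \<in> borel_measurable (restrict_space borel Xi)"
    and "\<And>x j. x \<in> X \<Longrightarrow> integrable (Q j) (\<phi> x)"
    and "\<theta>h \<in> weight_simplex"
    and "0 \<le> r"
  shows "uniform_limit X (\<lambda>lam x. opt_value Q \<phi> lam x \<theta>h r)
           (\<lambda>x. opt_value Q \<phi> 0 x \<theta>h r) (at_right 0)
    \<and> (\<forall>x\<in>X.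
          (\<forall>lam>0. \<exists>!\<theta>. \<theta> \<in> maximizers Q \<phi> lam x \<theta>h r)
        \<and> (\<exists>!\<theta>. is_arg_min norm (\<lambda>\<theta>. \<theta> \<in> maximizers Q \<phi> 0 x \<theta>h r) \<theta>)
        \<and> ((\<lambda>lam. the_elem (maximizers Q \<phi> lam x \<theta>h r))
             \<longlongrightarrow> arg_min norm (\<lambda>\<theta>. \<theta> \<in> maximizers Q \<phi> 0 x \<theta>h r)) (at_right 0))"
proof -
  define K where "K = ambiguity_set \<theta>h r"
  \<comment> \<open>The objective depends on \<open>x\<close> only through this vector of
    expectations, while \<open>K\<close> is the same for all \<open>x\<close>.\<close>
  define c where "c x = (\<chi> j. \<integral>\<xi>. \<phi> x \<xi> \<partial>Q j)" for x
  have K: "compact K" "convex K" "K \<noteq> {}"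
    using center_in_ambiguity_set[OF assms(9,10)]
    by (auto simp: K_def compact_ambiguity_set convex_ambiguity_set)
  have obj: "lower_obj Q \<phi> lam x = (\<lambda>\<theta>. c x \<bullet> \<theta> - lam * (norm \<theta>)\<^sup>2)" for lam x
    by (auto simp: lower_obj_eq_inner c_def)
  have obj0: "lower_obj Q \<phi> 0 x = (\<bullet>) (c x)" for x
    by (auto simp: obj)
  obtain B where B: "\<And>\<theta>. \<theta> \<in> K \<Longrightarrow> norm \<theta> \<le> B"
    using compact_imp_bounded[OF K(1)] by (auto simp: bounded_iff)
  \<comment> \<open>The linear parts cancel at each feasible point, leaving only the penalty, so the
    bound is uniform in \<open>x\<close>.\<close>
  have val: "\<bar>opt_value Q \<phi> lam x \<theta>h r - opt_value Q \<phi> 0 x \<theta>h r\<bar> \<le> lam * B\<^sup>2"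
    if "lam > 0" for lam x
    unfolding opt_value_def K_def[symmetric] obj
    using that K B by (intro abs_SUP_diff_le) (auto intro!: continuous_intros mult_left_mono power_mono)
  have "uniform_limit X (\<lambda>lam x. opt_value Q \<phi> lam x \<theta>h r)
           (\<lambda>x. opt_value Q \<phi> 0 x \<theta>h r) (at_right 0)"
  proof (rule uniform_limitI)
    fix e :: real
    assume "e > 0"
    have "((\<lambda>lam. lam * B\<^sup>2) \<longlongrightarrow> 0) (at_right 0)"
      by (auto intro!: tendsto_eq_intros)
    then have "\<forall>\<^sub>F lam in at_right 0. lam * B\<^sup>2 < e"
      using \<open>e > 0\<close> by (rule order_tendstoD(2))
    then show "\<forall>\<^sub>F lam in at_right 0. \<forall>x\<in>X.
        dist (opt_value Q \<phi> lam x \<theta>h r) (opt_value Q \<phi> 0 x \<theta>h r) < e"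
      using eventually_at_right_less[of "0::real"]
    proof eventually_elim
      case (elim lam)
      then show ?case
        using val[of lam] by (force simp: dist_real_def intro: le_less_trans)
    qed
  qed
  moreover have ex1_max: "\<exists>!\<theta>. \<theta> \<in> maximizers Q \<phi> lam x \<theta>h r" if "lam > 0" for lam x
    using ex1_arg_max_regularized[OF compact_imp_closed[OF K(1)] K(2,3) that]
    by (simp add: maximizers_def obj flip: K_def)
  moreover have ex1_min: "\<exists>!\<theta>. is_arg_min norm (\<lambda>\<theta>. \<theta> \<in> maximizers Q \<phi> 0 x \<theta>h r) \<theta>" for x
    unfolding maximizers_def K_def[symmetric] obj0
    by (intro ex1_arg_min_norm arg_max_inner_set K)
  moreover have "((\<lambda>lam. the_elem (maximizers Q \<phi> lam x \<theta>h r))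
      \<longlongrightarrow> arg_min norm (\<lambda>\<theta>. \<theta> \<in> maximizers Q \<phi> 0 x \<theta>h r)) (at_right 0)" for x
  proof (rule tendsto_regularized_arg_max[OF K(1)])
    let ?P = "is_arg_min norm (is_arg_max ((\<bullet>) (c x)) (\<lambda>\<theta>. \<theta> \<in> K))"
    let ?m = "arg_min norm (\<lambda>\<theta>. \<theta> \<in> maximizers Q \<phi> 0 x \<theta>h r)"
    \<comment> \<open>\<open>arg_min\<close> is a choice operator; unique existence pins down its
      value.\<close>
    have ex1: "\<exists>!\<theta>. ?P \<theta>" and m: "?m = (SOME \<theta>. ?P \<theta>)"
      using ex1_min[of x] by (simp_all add: maximizers_def obj0 arg_min_def flip: K_def)
    show "continuous_on K ((\<bullet>) (c x))"
      by (intro continuous_intros)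
    show "?P ?m"
      unfolding m using ex1 by (blast intro: someI_ex)
    then show "m' = ?m" if "?P m'" for m'
      using ex1 that by blast
    show "is_arg_max (\<lambda>\<theta>. c x \<bullet> \<theta> - t * (norm \<theta>)\<^sup>2) (\<lambda>\<theta>. \<theta> \<in> K)
        (the_elem (maximizers Q \<phi> t x \<theta>h r))" if "t > 0" for t
    proof -
      \<comment> \<open>\<open>the_elem\<close> is meaningful only on a singleton, so the maximizer
        set is first shown to be one.\<close>
      have "\<exists>\<theta>. maximizers Q \<phi> t x \<theta>h r = {\<theta>}"
        using ex1_max[OF that, of x] by blast
      then obtain \<theta> where "maximizers Q \<phi> t x \<theta>h r = {\<theta>}" ..
      moreover from this have "is_arg_max (lower_obj Q \<phi> t x) (\<lambda>\<theta>. \<theta> \<in> ambiguity_set \<theta>h r) \<theta>"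
        by (auto simp: maximizers_def)
      ultimately show ?thesis
        by (simp add: obj flip: K_def)
    qed
  qed
  ultimately show ?thesis
    by blast
qed

end
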